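(* Consider a multilayer network with nodes $i,j\in\{1,\dots,N\}$ and layers $s,r\in\{1,\dots,l\}$, within-layer adjacency $A_{ijs}$ and between-layer adjacency (couplings) $C_{isr}$, where $A_{iis}=0$ and $C_{iss}=0$. For each layer $s$ let $p_{ijs}$ be a null model satisfying $\sum_{i,j}A_{ijs}=\sum_{i,j}p_{ijs}$ (sums over all $i,j$), let $\gamma_s$ be the resolution parameter of layer $s$, and let $\varsigma$ be the coupling strength. Let $\mathcal{M}(\upsilon)$ be the multilayer edge mixture objective (defined in the context) with signs $\lambda_a=\lambda_d=\lambda_e=\lambda_h=+1$, $\lambda_b=\lambda_c=\lambda_f=\lambda_g=-1$ and hyper parameters $$a_{ijs}=c_{ijs}=1-\gamma_s p_{ijs},\quad b_{ijs}=d_{ijs}=\gamma_s p_{ijs},\quad e_{isr}=g_{isr}=\varsigma,\quad f_{isr}=h_{isr}=0.$$ Put $\tilde C_{isr}=\varsigma C_{isr}$, $m_s=\sum_{i,j}A_{ijs}$ and $m'_i=\sum_{s,r}\tilde C_{isr}$. Then $$\begin{aligned}\mathcal{M}(\upsilon)&=\sum_{i\neq j,\,s}(A_{ijs}-\gamma_sp_{ijs})[2P(\upsilon_{is},\upsilon_{js})-1]+\sum_{s\neq r,\,i}\varsigma C_{isr}[2P(\upsilon_{is},\upsilon_{ir})-1]\\&=2\Big[\sum_{i,j,s}(A_{ijs}-\gamma_s p_{ijs})P(\upsilon_{is},\upsilon_{js})+\sum_{i,s,r}\tilde C_{isr}P(\upsilon_{is},\upsilon_{ir})\Big]-\sum_s(1-\gamma_s)m_s-\sum_i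 m'_i ,\end{aligned}$$ where the last two sums are constant (independent of $\upsilon$). If the probability matrix $\mathbf P$ is diagonal and its entries take only binary values, so that $P$ is the Kronecker delta $\delta$, then $$\mathcal{M}(\upsilon)=2\sum_{i,j,s,r}\big[(A_{ijs}-\gamma_s p_{ijs})\delta_{sr}+\tilde C_{isr}\delta_{ij}\big]\delta(\upsilon_{is},\upsilon_{jr})-\sum_s(1-\gamma_s)m_s-\sum_i m'_i ,$$ and maximizing $\mathcal{M}(\upsilon)$ is equivalent to maximizing the multilayer modularity $\sum_{i,j,s,r}\big[(A_{ijs}-\gamma_s p_{ijs})\delta_{sr}+\tilde C_{isr}\delta_{ij}\big]\delta(\upsilon_{is},\upsilon_{jr})$.
   Context: All $l$ layers of the network share the same set of $N$ nodes; each layer is a simple graph, and the layers are linked only by couplings between a node and its copies in other layers. A community labelling $\upsilon$ assigns to each pair (node $i$, layer $s$) a community label $\upsilon_{is}$. $P(\upsilon_{is},\upsilon_{jr})\in[0,1]$ is the probability that node $i$ in layer $s$ and node $j$ in layer $r$ belong to the same community (or of having edges between their communities), and $\mathbf P$ is the matrix of the values of $P$ indexed by pairs of labels. The multilayer edge mixture (MEMM) objective with signs $\lambda_a,\dots,\lambda_h\in\{+1,-1\}$ and hyper parameters $a_{ijs},b_{ijs},c_{ijs},d_{ijs},e_{isr},f_{isr},g_{isr},h_{isr}$ is $$\begin{aligned}\mathcal{M}(\upsilon)=&\sum_{i\neq j,\,s}\Big(\lambda_a a_{ijs}A_{ijs}P(\upsilon_{is},\upsilon_{js})+\lambda_b b_{ijs}(1-A_{ijs})P(\upsilon_{is},\upsilon_{js})\\&\qquad+\lambda_c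 c_{ijs}A_{ijs}[1-P(\upsilon_{is},\upsilon_{js})]+\lambda_d d_{ijs}(1-A_{ijs})[1-P(\upsilon_{is},\upsilon_{js})]\Big)\\&+\sum_{s\ne r,\,i}\Big(\lambda_e e_{isr}C_{isr}P(\upsilon_{is},\upsilon_{ir})+\lambda_f f_{isr}(1-C_{isr})P(\upsilon_{is},\upsilon_{ir})\\&\qquad+\lambda_g g_{isr}C_{isr}[1-P(\upsilon_{is},\upsilon_{ir})]+\lambda_h h_{isr}(1-C_{isr})[1-P(\upsilon_{is},\upsilon_{ir})]\Big).\end{aligned}$$ Here a null model $p_{ijs}$ is the expected edge strength between $i$ and $j$ in a randomly rewired version of layer $s$; an example is $k_{is}k_{js}/(2m_s)$ with $k_{is}$ the within-layer degree and, in this example, $2m_s$ standing for $\sum_i k_{is}$.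
   Formalization: The second and third expressions for M are claimed when p_iis = 0, and for general p with the added term sum over i,s of γ_s p_iis [2P(υ_is,υ_is) − 1], without which they fail; "P is diagonal and binary" also requires non-zero diagonal entries, so that P = δ. *)

theory Defs
  imports Complex_Main
begin

text \<open>
  Nodes and layers are the elements of finite types \<open>'n\<close> and \<open>'l\<close>, community labels those of an
  arbitrary type \<open>'c\<close>.  Within-layer arrays \<open>A i j s\<close> take two nodes and a layer; couplings
  \<open>C i s r\<close> take a node and two layers.  A labelling maps \<open>i\<close> and \<open>s\<close> to the label of the copy of
  node \<open>i\<close> in layer \<open>s\<close>, and \<open>P\<close> is a matrix indexed by pairs of labels.
\<close>

definition simple_layers :: "('n \<Rightarrow> 'n \<Rightarrow> 'l \<Rightarrow> real) \<Rightarrow> bool" where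
  "simple_layers A \<longleftrightarrow>
     (\<forall>i j s. A i j s \<in> {0, 1} \<and> A i j s = A j i s) \<and> (\<forall>i s. A i i s = 0)"

record memm_signs =
  sign_a :: real
  sign_b :: real
  sign_c :: real
  sign_d :: real
  sign_e :: real
  sign_f :: real
  sign_g :: real
  sign_h :: real

record ('n, 'l) memm_params =
  par_a :: "'n \<Rightarrow> 'n \<Rightarrow> 'l \<Rightarrow> real"
  par_b :: "'n \<Rightarrow> 'n \<Rightarrow> 'l \<Rightarrow> real"
  par_c :: "'n \<Rightarrow> 'n \<Rightarrow> 'l \<Rightarrow> real"
  par_d :: "'n \<Rightarrow> 'n \<Rightarrow> 'l \<Rightarrow> real"
  par_e :: "'n \<Rightarrow> 'l \<Rightarrow> 'l \<Rightarrow> real"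
  par_f :: "'n \<Rightarrow> 'l \<Rightarrow> 'l \<Rightarrow> real"
  par_g :: "'n \<Rightarrow> 'l \<Rightarrow> 'l \<Rightarrow> real"
  par_h :: "'n \<Rightarrow> 'l \<Rightarrow> 'l \<Rightarrow> real"

definition memm ::
  "memm_signs \<Rightarrow> ('n::finite, 'l::finite) memm_params \<Rightarrow>
   ('n \<Rightarrow> 'n \<Rightarrow> 'l \<Rightarrow> real) \<Rightarrow> ('n \<Rightarrow> 'l \<Rightarrow> 'l \<Rightarrow> real) \<Rightarrow>
   ('c \<Rightarrow> 'c \<Rightarrow> real) \<Rightarrow> ('n \<Rightarrow> 'l \<Rightarrow> 'c) \<Rightarrow> real" where
  "memm sg w A C P \<upsilon> =
     (\<Sum>(i, j, s)\<in>{(i, j, s). i \<noteq> j}.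
          sign_a sg * par_a w i j s * A i j s * P (\<upsilon> i s) (\<upsilon> j s)
        + sign_b sg * par_b w i j s * (1 - A i j s) * P (\<upsilon> i s) (\<upsilon> j s)
        + sign_c sg * par_c w i j s * A i j s * (1 - P (\<upsilon> i s) (\<upsilon> j s))
        + sign_d sg * par_d w i j s * (1 - A i j s) * (1 - P (\<upsilon> i s) (\<upsilon> j s)))
   + (\<Sum>(i, s, r)\<in>{(i, s, r). s \<noteq> r}.
          sign_e sg * par_e w i s r * C i s r * P (\<upsilon> i s) (\<upsilon> i r)
        + sign_f sg * par_f w i s r * (1 - C i s r) * P (\<upsilon> i s) (\<upsilon> i r)
        + sign_g sg * par_g w i s r * C i s r * (1 - P (\<upsilon> i s) (\<upsilon> i r))
        + sign_h sg * par_h w i s r * (1 - C i s r) * (1 - P (\<upsilon> i s) (\<upsilon> i r)))"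

definition modularity_signs :: memm_signs where
  "modularity_signs =
     \<lparr>sign_a = 1, sign_b = -1, sign_c = -1, sign_d = 1,
      sign_e = 1, sign_f = -1, sign_g = -1, sign_h = 1\<rparr>"

definition modularity_params ::
  "('l \<Rightarrow> real) \<Rightarrow> ('n \<Rightarrow> 'n \<Rightarrow> 'l \<Rightarrow> real) \<Rightarrow> real \<Rightarrow> ('n, 'l) memm_params" where
  "modularity_params \<gamma> p \<sigma> =
     \<lparr>par_a = (\<lambda>i j s. 1 - \<gamma> s * p i j s),
      par_b = (\<lambda>i j s. \<gamma> s * p i j s),
      par_c = (\<lambda>i j s. 1 - \<gamma> s * p i j s),
      par_d = (\<lambda>i j s. \<gamma> s * p i j s),
      par_e = (\<lambda>i s r. \<sigma>),
      par_f = (\<lambda>i s r. 0),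
      par_g = (\<lambda>i s r. \<sigma>),
      par_h = (\<lambda>i s r. 0)\<rparr>"

definition kdelta :: "'a \<Rightarrow> 'a \<Rightarrow> real" where
  "kdelta x y = (if x = y then 1 else 0)"

definition scaled_coupling :: "real \<Rightarrow> ('n \<Rightarrow> 'l \<Rightarrow> 'l \<Rightarrow> real) \<Rightarrow> 'n \<Rightarrow> 'l \<Rightarrow> 'l \<Rightarrow> real" where
  "scaled_coupling \<sigma> C i s r = \<sigma> * C i s r"

text \<open>The sum runs over ordered pairs, so each edge of the layer is counted twice.\<close>

definition layer_total :: "('n::finite \<Rightarrow> 'n \<Rightarrow> 'l \<Rightarrow> real) \<Rightarrow> 'l \<Rightarrow> real" where
  "layer_total A s = (\<Sum>i\<in>UNIV. \<Sum>j\<in>UNIV. A i j s)"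

definition node_total :: "real \<Rightarrow> ('n \<Rightarrow> 'l::finite \<Rightarrow> 'l \<Rightarrow> real) \<Rightarrow> 'n \<Rightarrow> real" where
  "node_total \<sigma> C i = (\<Sum>s\<in>UNIV. \<Sum>r\<in>UNIV. scaled_coupling \<sigma> C i s r)"

text \<open>
  Unlike in \<open>memm\<close>, the pairs with \<open>i = j\<close> are included here, so that \<open>p i i s\<close> enters the sum.
\<close>

definition multilayer_modularity ::
  "('l::finite \<Rightarrow> real) \<Rightarrow> ('n::finite \<Rightarrow> 'n \<Rightarrow> 'l \<Rightarrow> real) \<Rightarrow> real \<Rightarrow>
   ('n \<Rightarrow> 'n \<Rightarrow> 'l \<Rightarrow> real) \<Rightarrow> ('n \<Rightarrow> 'l \<Rightarrow> 'l \<Rightarrow> real) \<Rightarrow> ('n \<Rightarrow> 'l \<Rightarrow> 'c) \<Rightarrow> real" where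
  "multilayer_modularity \<gamma> p \<sigma> A C \<upsilon> =
     (\<Sum>i\<in>UNIV. \<Sum>j\<in>UNIV. \<Sum>s\<in>UNIV. \<Sum>r\<in>UNIV.
        ((A i j s - \<gamma> s * p i j s) * kdelta s r + scaled_coupling \<sigma> C i s r * kdelta i j)
        * kdelta (\<upsilon> i s) (\<upsilon> j r))"

end

theory Submission
  imports Defs
begin

text \<open>
  In each summand of the objective the four terms collapse to an edge weight times
  \<open>2 * P - 1\<close>.  Extending the within-layer sum to the diagonal brings in the terms with
  \<open>p i i s\<close>, which depend on the labelling only through \<open>P x x\<close>; for the Kronecker delta this
  is \<open>1\<close>, so the objective is then a positive affine function of the modularity.
\<close>

lemma sum_UNIV_triple:
  fixes f :: "'a::finite \<Rightarrow> 'b::finite \<Rightarrow> 'c::finite \<Rightarrow> 'd::comm_monoid_add"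
  shows "(\<Sum>(i, j, s)\<in>UNIV. f i j s) = (\<Sum>i\<in>UNIV. \<Sum>j\<in>UNIV. \<Sum>s\<in>UNIV. f i j s)"
  by (simp add: sum.cartesian_product)

text \<open>The diagonal is subtracted rather than dropped, because null model entries
  \<open>p i i s\<close> may be nonzero. Projecting \<open>(i, i, s)\<close> to
  \<open>(i, s)\<close> parametrizes it.\<close>

lemma sum_fst_neq_snd:
  fixes f :: "'a::finite \<Rightarrow> 'a \<Rightarrow> 'b::finite \<Rightarrow> 'd::ab_group_add"
  shows "(\<Sum>(i, j, s)\<in>{(i, j, s). i \<noteq> j}. f i j s)
       = (\<Sum>(i, j, s)\<in>UNIV. f i j s) - (\<Sum>i\<in>UNIV. \<Sum>s\<in>UNIV. f i i s)"
proof -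
  have diag: "(\<Sum>(i, j, s)\<in>{(i, j, s). i = j}. f i j s) = (\<Sum>(i, s)\<in>UNIV. f i i s)"
    by (rule sum.reindex_bij_witness[where i = "\<lambda>(i, s). (i, i, s)" and j = "\<lambda>(i, j, s). (i, s)"])
      auto
  have compl: "{(i :: 'a, j, s :: 'b). i \<noteq> j} = UNIV - {(i, j, s). i = j}"
    by auto
  show ?thesis
    unfolding compl by (simp add: sum_diff diag sum.cartesian_product)
qed

text \<open>The factor \<open>1 - P\<close> carries the same parameters as \<open>P\<close> with
  opposite signs, so each bracket is a weight times P - (1 - P). Within a layer the weight is A (1 -
  \<gamma> p) - (1 - A) \<gamma> p = A - \<gamma> p; between layers it is \<sigma> C.\<close>

lemma memm_modularity:
  "memm modularity_signs (modularity_params \<gamma> p \<sigma>) A C P \<upsilon> =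
     (\<Sum>(i, j, s)\<in>{(i, j, s). i \<noteq> j}.
         (A i j s - \<gamma> s * p i j s) * (2 * P (\<upsilon> i s) (\<upsilon> j s) - 1))
   + (\<Sum>(i, s, r)\<in>{(i, s, r). s \<noteq> r}.
         \<sigma> * C i s r * (2 * P (\<upsilon> i s) (\<upsilon> i r) - 1))"
  unfolding memm_def modularity_signs_def modularity_params_def
  by (intro arg_cong2[where f = "(+)"] sum.cong refl) (auto simp: algebra_simps)

text \<open>The \<open>- 1\<close> in \<open>2 * Q i j s - 1\<close> produces the constant: in each
  layer the null model has the same total as \<open>A\<close>, so the weights A - \<gamma> p add up
  to (1 - \<gamma>) times that total.\<close>

lemma sum_within_layers:
  fixes A p :: "'n::finite \<Rightarrow> 'n \<Rightarrow> 'l::finite \<Rightarrow> real"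
  assumes "\<And>i s. A i i s = 0"
    and "\<And>s. (\<Sum>i\<in>UNIV. \<Sum>j\<in>UNIV. A i j s) = (\<Sum>i\<in>UNIV. \<Sum>j\<in>UNIV. p i j s)"
  shows "(\<Sum>(i, j, s)\<in>{(i, j, s). i \<noteq> j}. (A i j s - \<gamma> s * p i j s) * (2 * Q i j s - 1))
       = 2 * (\<Sum>(i, j, s)\<in>UNIV. (A i j s - \<gamma> s * p i j s) * Q i j s)
         - (\<Sum>s\<in>UNIV. (1 - \<gamma> s) * layer_total A s)
         + (\<Sum>i\<in>UNIV. \<Sum>s\<in>UNIV. \<gamma> s * p i i s * (2 * Q i i s - 1))"
proof -
  \<comment> \<open>The totals of \<open>A\<close> and \<open>p\<close> agree layer by layer, so the
    sum over \<open>s\<close> is first moved outermost, past \<open>j\<close> and then past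
    \<open>i\<close>.\<close>
  have "(\<Sum>i\<in>UNIV. \<Sum>j\<in>UNIV. \<Sum>s\<in>UNIV. A i j s - \<gamma> s * p i j s)
      = (\<Sum>i\<in>UNIV. \<Sum>s\<in>UNIV. \<Sum>j\<in>UNIV. A i j s - \<gamma> s * p i j s)"
    by (intro sum.cong refl) (rule sum.swap)
  also have "\<dots> = (\<Sum>s\<in>UNIV. \<Sum>i\<in>UNIV. \<Sum>j\<in>UNIV. A i j s - \<gamma> s * p i j s)"
    by (rule sum.swap)
  also have "\<dots> = (\<Sum>s\<in>UNIV. (1 - \<gamma> s) * layer_total A s)"
    by (intro sum.cong refl)
      (simp add: layer_total_def sum_subtractf assms(2) left_diff_distrib flip: sum_distrib_left)
  finally have const: "(\<Sum>i\<in>UNIV. \<Sum>j\<in>UNIV. \<Sum>s\<in>UNIV. A i j s - \<gamma> s * p i j s)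
      = (\<Sum>s\<in>UNIV. (1 - \<gamma> s) * layer_total A s)" .
  have "(\<Sum>(i, j, s)\<in>UNIV. (A i j s - \<gamma> s * p i j s) * (2 * Q i j s - 1))
      = 2 * (\<Sum>(i, j, s)\<in>UNIV. (A i j s - \<gamma> s * p i j s) * Q i j s)
        - (\<Sum>i\<in>UNIV. \<Sum>j\<in>UNIV. \<Sum>s\<in>UNIV. A i j s - \<gamma> s * p i j s)"
    unfolding sum_UNIV_triple sum_distrib_left sum_subtractf[symmetric]
    by (intro sum.cong refl) (simp add: algebra_simps)
  \<comment> \<open>On the diagonal \<open>A\<close> vanishes and the weight is - \<gamma> p, hence
    removing these terms adds the last sum with a plus sign.\<close>
  then show ?thesis
    by (simp add: sum_fst_neq_snd assms(1) const sum_negf)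
qed

text \<open>Here the diagonal terms s = r vanish with \<open>C i s s\<close>, so extending the range
  leaves no correction.\<close>

lemma sum_couplings:
  fixes C :: "'n::finite \<Rightarrow> 'l::finite \<Rightarrow> 'l \<Rightarrow> real"
  assumes "\<And>i s. C i s s = 0"
  shows "(\<Sum>(i, s, r)\<in>{(i, s, r). s \<noteq> r}. \<sigma> * C i s r * (2 * Q i s r - 1))
       = 2 * (\<Sum>(i, s, r)\<in>UNIV. scaled_coupling \<sigma> C i s r * Q i s r)
         - (\<Sum>i\<in>UNIV. node_total \<sigma> C i)"
proof -
  have "(\<Sum>(i, s, r)\<in>{(i, s, r). s \<noteq> r}. \<sigma> * C i s r * (2 * Q i s r - 1))
      = (\<Sum>(i, s, r)\<in>UNIV. \<sigma> * C i s r * (2 * Q i s r - 1))"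
    by (rule sum.mono_neutral_left) (auto simp: assms)
  then show ?thesis
    unfolding sum_UNIV_triple node_total_def sum_distrib_left sum_subtractf[symmetric]
    by (simp add: scaled_coupling_def algebra_simps)
qed

lemma multilayer_modularity_triple:
  fixes A p :: "'n::finite \<Rightarrow> 'n \<Rightarrow> 'l::finite \<Rightarrow> real"
    and \<upsilon> :: "'n \<Rightarrow> 'l \<Rightarrow> 'c"
  shows "multilayer_modularity \<gamma> p \<sigma> A C \<upsilon> =
     (\<Sum>(i, j, s)\<in>UNIV. (A i j s - \<gamma> s * p i j s) * kdelta (\<upsilon> i s) (\<upsilon> j s))
   + (\<Sum>(i, s, r)\<in>UNIV. scaled_coupling \<sigma> C i s r * kdelta (\<upsilon> i s) (\<upsilon> i r))"
proof -
  \<comment> \<open>\<open>if_distrib\<close> pulls the conditional of \<open>kdelta s r\<close> out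
    of the product, so that only r = s survives.\<close>
  have within: "(\<Sum>r\<in>UNIV. w * kdelta s r * kdelta x (f r)) = w * kdelta x (f s)"
    for w and s :: 'l and x :: 'c and f
    by (simp add: kdelta_def if_distrib[of "\<lambda>z. _ * z * _"] cong: if_cong)
  have between: "(\<Sum>j\<in>UNIV. \<Sum>s\<in>UNIV. \<Sum>r\<in>UNIV. scaled_coupling \<sigma> C i s r * kdelta i j * kdelta (\<upsilon> i s) (\<upsilon> j r))
      = (\<Sum>s\<in>UNIV. \<Sum>r\<in>UNIV. scaled_coupling \<sigma> C i s r * kdelta (\<upsilon> i s) (\<upsilon> i r))" for i
  proof -
    \<comment> \<open>The condition i = j does not involve the layers; outside both layer sums it
      leaves a sum over \<open>j\<close> with one nonzero term.\<close>
    have "(\<Sum>s\<in>UNIV. \<Sum>r\<in>UNIV. scaled_coupling \<sigma> C i s r * kdelta i j * kdelta (\<upsilon> i s) (\<upsilon> j r))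
        = (if i = j then \<Sum>s\<in>UNIV. \<Sum>r\<in>UNIV. scaled_coupling \<sigma> C i s r * kdelta (\<upsilon> i s) (\<upsilon> i r) else 0)"
      for j
      by (simp add: kdelta_def)
    then show ?thesis
      by simp
  qed
  show ?thesis
    unfolding multilayer_modularity_def sum_UNIV_triple
    by (simp add: distrib_right sum.distrib within between)
qed

lemma is_arg_max_affine:
  fixes f g :: "'a \<Rightarrow> 'b::linordered_idom"
  assumes "\<And>x. f x = a * g x + b" and "0 < a"
  shows "is_arg_max f P x \<longleftrightarrow> is_arg_max g P x"
  using assms by (simp add: is_arg_max_def)

theorem mainTheorem1:
  fixes A p :: "'n::finite \<Rightarrow> 'n \<Rightarrow> 'l::finite \<Rightarrow> real"
    and C :: "'n \<Rightarrow> 'l \<Rightarrow> 'l \<Rightarrow> real"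
    and \<gamma> :: "'l \<Rightarrow> real"
    and \<sigma> :: real
    and P :: "'c \<Rightarrow> 'c \<Rightarrow> real"
    and M :: "('n \<Rightarrow> 'l \<Rightarrow> 'c) \<Rightarrow> real"
  assumes layers: "simple_layers A"
    and couplings: "\<forall>i s. C i s s = 0"
    and null_model: "\<forall>s. (\<Sum>i\<in>UNIV. \<Sum>j\<in>UNIV. A i j s) = (\<Sum>i\<in>UNIV. \<Sum>j\<in>UNIV. p i j s)"
    and prob: "\<forall>x y. 0 \<le> P x y \<and> P x y \<le> 1"
    and objective: "M = memm modularity_signs (modularity_params \<gamma> p \<sigma>) A C P"
  shows
    "(\<forall>\<upsilon>. M \<upsilon> =
        (\<Sum>(i, j, s)\<in>{(i, j, s). i \<noteq> j}.
            (A i j s - \<gamma> s * p i j s) * (2 * P (\<upsilon> i s) (\<upsilon> j s) - 1))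
      + (\<Sum>(i, s, r)\<in>{(i, s, r). s \<noteq> r}.
            \<sigma> * C i s r * (2 * P (\<upsilon> i s) (\<upsilon> i r) - 1)))
     \<and> ((\<forall>i s. p i i s = 0) \<longrightarrow> (\<forall>\<upsilon>. M \<upsilon> =
        2 * ((\<Sum>(i, j, s)\<in>UNIV. (A i j s - \<gamma> s * p i j s) * P (\<upsilon> i s) (\<upsilon> j s))
           + (\<Sum>(i, s, r)\<in>UNIV. scaled_coupling \<sigma> C i s r * P (\<upsilon> i s) (\<upsilon> i r)))
      - (\<Sum>s\<in>UNIV. (1 - \<gamma> s) * layer_total A s) - (\<Sum>i\<in>UNIV. node_total \<sigma> C i)))
     \<and> (\<forall>\<upsilon>. M \<upsilon> =
        2 * ((\<Sum>(i, j, s)\<in>UNIV. (A i j s - \<gamma> s * p i j s) * P (\<upsilon> i s) (\<upsilon> j s))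
           + (\<Sum>(i, s, r)\<in>UNIV. scaled_coupling \<sigma> C i s r * P (\<upsilon> i s) (\<upsilon> i r)))
      - (\<Sum>s\<in>UNIV. (1 - \<gamma> s) * layer_total A s) - (\<Sum>i\<in>UNIV. node_total \<sigma> C i)
      + (\<Sum>i\<in>UNIV. \<Sum>s\<in>UNIV. \<gamma> s * p i i s * (2 * P (\<upsilon> i s) (\<upsilon> i s) - 1)))
     \<and> ((\<forall>x y. x \<noteq> y \<longrightarrow> P x y = 0) \<and> (\<forall>x y. P x y \<in> {0, 1}) \<and> (\<forall>x. P x x \<noteq> 0) \<longrightarrow>
        P = kdelta
      \<and> ((\<forall>i s. p i i s = 0) \<longrightarrow> (\<forall>\<upsilon>. M \<upsilon> =
            2 * multilayer_modularity \<gamma> p \<sigma> A C \<upsilon>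
          - (\<Sum>s\<in>UNIV. (1 - \<gamma> s) * layer_total A s) - (\<Sum>i\<in>UNIV. node_total \<sigma> C i)))
      \<and> (\<forall>\<upsilon>. M \<upsilon> =
            2 * multilayer_modularity \<gamma> p \<sigma> A C \<upsilon>
          - (\<Sum>s\<in>UNIV. (1 - \<gamma> s) * layer_total A s) - (\<Sum>i\<in>UNIV. node_total \<sigma> C i)
          + (\<Sum>i\<in>UNIV. \<Sum>s\<in>UNIV. \<gamma> s * p i i s))
      \<and> (\<forall>U \<upsilon>. is_arg_max M (\<lambda>u. u \<in> U) \<upsilon> \<longleftrightarrow>
            is_arg_max (multilayer_modularity \<gamma> p \<sigma> A C) (\<lambda>u. u \<in> U) \<upsilon>))"
proof -
  let ?full = "\<lambda>\<upsilon>. 2 * ((\<Sum>(i, j, s)\<in>UNIV. (A i j s - \<gamma> s * p i j s) * P (\<upsilon> i s) (\<upsilon> j s))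
           + (\<Sum>(i, s, r)\<in>UNIV. scaled_coupling \<sigma> C i s r * P (\<upsilon> i s) (\<upsilon> i r)))
      - (\<Sum>s\<in>UNIV. (1 - \<gamma> s) * layer_total A s) - (\<Sum>i\<in>UNIV. node_total \<sigma> C i)"
  have offdiag: "M \<upsilon> =
        (\<Sum>(i, j, s)\<in>{(i, j, s). i \<noteq> j}.
            (A i j s - \<gamma> s * p i j s) * (2 * P (\<upsilon> i s) (\<upsilon> j s) - 1))
      + (\<Sum>(i, s, r)\<in>{(i, s, r). s \<noteq> r}.
            \<sigma> * C i s r * (2 * P (\<upsilon> i s) (\<upsilon> i r) - 1))" for \<upsilon>
    unfolding objective by (rule memm_modularity)
  have no_loops: "A i i s = 0" for i s
    using layers by (simp add: simple_layers_def)
  have full: "M \<upsilon> = ?full \<upsilon>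
      + (\<Sum>i\<in>UNIV. \<Sum>s\<in>UNIV. \<gamma> s * p i i s * (2 * P (\<upsilon> i s) (\<upsilon> i s) - 1))" for \<upsilon>
    unfolding offdiag
    using sum_within_layers[of A p \<gamma> "\<lambda>i j s. P (\<upsilon> i s) (\<upsilon> j s)"]
      sum_couplings[of C \<sigma> "\<lambda>i s r. P (\<upsilon> i s) (\<upsilon> i r)"]
      no_loops null_model couplings
    by simp
  have kronecker: "P = kdelta"
      "M \<upsilon> = 2 * multilayer_modularity \<gamma> p \<sigma> A C \<upsilon>
          - (\<Sum>s\<in>UNIV. (1 - \<gamma> s) * layer_total A s) - (\<Sum>i\<in>UNIV. node_total \<sigma> C i)
          + (\<Sum>i\<in>UNIV. \<Sum>s\<in>UNIV. \<gamma> s * p i i s)"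
      "is_arg_max M (\<lambda>u. u \<in> U) \<upsilon> \<longleftrightarrow>
          is_arg_max (multilayer_modularity \<gamma> p \<sigma> A C) (\<lambda>u. u \<in> U) \<upsilon>"
    if binary: "(\<forall>x y. x \<noteq> y \<longrightarrow> P x y = 0) \<and> (\<forall>x y. P x y \<in> {0, 1}) \<and> (\<forall>x. P x x \<noteq> 0)" for \<upsilon> U
  proof -
    \<comment> \<open>A diagonal entry lies in {0, 1} and is nonzero, hence equals 1.\<close>
    show delta: "P = kdelta"
      using binary by (fastforce simp: kdelta_def fun_eq_iff)
    \<comment> \<open>Generalized over \<upsilon> again, since \<open>is_arg_max\<close> compares
      the given labelling with all its competitors.\<close>
    show affine: "M \<upsilon> = 2 * multilayer_modularity \<gamma> p \<sigma> A C \<upsilon>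
          - (\<Sum>s\<in>UNIV. (1 - \<gamma> s) * layer_total A s) - (\<Sum>i\<in>UNIV. node_total \<sigma> C i)
          + (\<Sum>i\<in>UNIV. \<Sum>s\<in>UNIV. \<gamma> s * p i i s)" for \<upsilon>
      \<comment> \<open>For \<open>kdelta\<close> the factor 2 P x x - 1 is 1, so the diagonal
        correction no longer depends on the labelling.\<close>
      unfolding full delta multilayer_modularity_triple by (simp add: kdelta_def)
    show "is_arg_max M (\<lambda>u. u \<in> U) \<upsilon> \<longleftrightarrow>
        is_arg_max (multilayer_modularity \<gamma> p \<sigma> A C) (\<lambda>u. u \<in> U) \<upsilon>"
      by (rule is_arg_max_affine[where a = 2 and
            b = "(\<Sum>i\<in>UNIV. \<Sum>s\<in>UNIV. \<gamma> s * p i i s)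
              - (\<Sum>s\<in>UNIV. (1 - \<gamma> s) * layer_total A s) - (\<Sum>i\<in>UNIV. node_total \<sigma> C i)"])
        (simp_all add: affine)
  qed
  \<comment> \<open>A null model without self-loops makes the diagonal correction vanish for every
    \<open>P\<close>.\<close>
  have full_no_loops: "M \<upsilon> = ?full \<upsilon>" if "\<forall>i s. p i i s = 0" for \<upsilon>
    using that by (simp add: full)
  have kronecker_no_loops: "M \<upsilon> = 2 * multilayer_modularity \<gamma> p \<sigma> A C \<upsilon>
          - (\<Sum>s\<in>UNIV. (1 - \<gamma> s) * layer_total A s) - (\<Sum>i\<in>UNIV. node_total \<sigma> C i)"
    if "(\<forall>x y. x \<noteq> y \<longrightarrow> P x y = 0) \<and> (\<forall>x y. P x y \<in> {0, 1}) \<and> (\<forall>x. P x x \<noteq> 0)"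
      and "\<forall>i s. p i i s = 0" for \<upsilon>
    using kronecker(2)[OF that(1)] that(2) by simp
  show ?thesis
    \<comment> \<open>The outer conjunction and the one under the Kronecker hypothesis both have
      four members, so the nested \<open>conjI\<close> splits each at once. The hypothesis remains
      one conjunction, as \<open>kronecker\<close> expects.\<close>
    by (intro conjI[OF _ conjI[OF _ conjI]] impI allI)
      (assumption | rule offdiag full full_no_loops kronecker kronecker_no_loops)+
qed

end
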